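(* Let $\alpha\in\mathbb{R}$ and $\beta\in\mathbb{R}\setminus\{0\}$ satisfy $\alpha/\beta>-13$. Then there exists $s_0\in(0,\infty)$ with $$31\alpha^3+212940\,\alpha\beta^2e_4(s_0)+2768220\,\beta^3e_6(s_0)=0,$$ and, for such an $s_0$, with $$c=\frac{31\alpha^2}{507\beta}-\frac{140}{13}\alpha\left(e_2(s_0)-\frac{s_0}{\pi}\right)-140\beta e_4(s_0),$$ the function $$v(z,t)=\frac{140}{13}\alpha\,u_{s_0}(z-ct)-140\beta\,u_{s_0}''(z-ct)$$ is a ($2\pi$-periodic in $z$) solution of the Kawahara equation $$v_t+vv_z+\alpha v_{zzz}-\beta v_{zzzzz}=0.$$
   Context: For $s>0$, $u_s$ is the $2\pi$-periodic function $u_s(x)=\sum_{k\in\mathbb{Z}}\frac{k}{\sinh(k\pi/s)}e^{-ikx}$, where the $k=0$ coefficient is understood as the limit $s/\pi$. The quantities $e_2,e_4,e_6$ are the functions of $s>0$ given by $$e_2(s)=\frac16+4\sum_{k=1}^\infty\frac{k}{1-e^{2\pi k/s}},\quad e_4(s)=-\frac1{60}+4\sum_{k=1}^\infty\frac{k^3}{1-e^{2\pi k/s}},\quad e_6(s)=\frac1{126}+4\sum_{k=1}^\infty\frac{k^5}{1-e^{2\pi k/s}}.$$ *)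

theory Defs
  imports "HOL-Analysis.Analysis"
begin

text \<open>The value at \<open>k = 0\<close> is the limit of \<open>k / sinh (k * pi / s)\<close> as \<open>k\<close> tends to \<open>0\<close>.\<close>

definition u_coeff :: "real \<Rightarrow> int \<Rightarrow> real" where
  "u_coeff s k = (if k = 0 then s / pi else of_int k / sinh (of_int k * pi / s))"

definition u :: "real \<Rightarrow> real \<Rightarrow> real" where
  "u s x = Re (\<Sum>\<^sub>\<infinity>k\<in>(UNIV :: int set). of_real (u_coeff s k) * exp (- \<i> * of_int k * of_real x))"

text \<open>Taking the real part loses nothing: the Fourier series is real, because its coefficients
  are real and even in \<open>k\<close>.\<close>

lemma of_real_u:
  "complex_of_real (u s x) =
     (\<Sum>\<^sub>\<infinity>k\<in>(UNIV :: int set). of_real (u_coeff s k) * exp (- \<i> * of_int k * of_real x))"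
proof -
  define f :: "int \<Rightarrow> complex"
    where "f k = of_real (u_coeff s k) * exp (- \<i> * of_int k * of_real x)" for k
  have cnj_f: "cnj (f k) = f (- k)" for k
    by (simp add: f_def u_coeff_def exp_cnj)
  have "cnj (infsum f UNIV) = (\<Sum>\<^sub>\<infinity>k. f (- k))"
    by (simp flip: infsum_cnj add: cnj_f)
  also have "\<dots> = infsum f UNIV"
    by (rule infsum_reindex_bij_betw[of uminus]) (rule bij_uminus)
  finally have "infsum f UNIV \<in> \<real>"
    by (simp add: Reals_cnj_iff)
  then show ?thesis
    unfolding u_def f_def by (rule of_real_Re)
qed

definition e2 :: "real \<Rightarrow> real" where
  "e2 s = 1 / 6 + 4 * (\<Sum>n. real (Suc n) / (1 - exp (2 * pi * real (Suc n) / s)))"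

definition e4 :: "real \<Rightarrow> real" where
  "e4 s = - 1 / 60 + 4 * (\<Sum>n. real (Suc n) ^ 3 / (1 - exp (2 * pi * real (Suc n) / s)))"

definition e6 :: "real \<Rightarrow> real" where
  "e6 s = 1 / 126 + 4 * (\<Sum>n. real (Suc n) ^ 5 / (1 - exp (2 * pi * real (Suc n) / s)))"

text \<open>Classical solutions on \<open>\<real> \<times> \<real>\<close>. Since \<^const>\<open>deriv\<close> is total, the existence of every partial
  derivative occurring in the equation is required explicitly.\<close>

definition kawahara_solution :: "real \<Rightarrow> real \<Rightarrow> (real \<Rightarrow> real \<Rightarrow> real) \<Rightarrow> bool" where
  "kawahara_solution \<alpha> \<beta> v \<longleftrightarrow>
     (\<forall>z t. v z differentiable at t) \<and>
     (\<forall>z t. \<forall>i<5. (deriv ^^ i) (\<lambda>y. v y t) differentiable at z) \<and>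
     (\<forall>z t. deriv (v z) t + v z t * deriv (\<lambda>y. v y t) z
              + \<alpha> * (deriv ^^ 3) (\<lambda>y. v y t) z
              - \<beta> * (deriv ^^ 5) (\<lambda>y. v y t) z = 0)"

end

theory Submission
  imports Defs "HOL-Library.Nat_Bijection"
begin

text \<open>The wave profile is a cosine series with coefficients \<open>V k = (p + q k\<^sup>2) a k\<close>, where
  \<open>a k = k / sinh (k h)\<close> and \<open>h = pi / s\<close>. The partial fraction identity
  \<open>1 / (sinh x * sinh y) = (coth x + coth y) / sinh (x + y)\<close> turns the convolution square of \<open>V\<close> at
  \<open>k \<noteq> 0\<close> into a telescoping sum of polynomials times \<open>coth (j h)\<close>. Splitting \<open>coth (j h)\<close> into
  \<open>sgn j\<close> and an odd rapidly decreasing remainder gives finite power sums and the moments of orders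
  1, 3, 5 of the remainder, that is, \<open>e2\<close>, \<open>e4\<close>, \<open>e6\<close>. The result is
  \<open>2 V k (c + \<alpha> k\<^sup>2 + \<beta> k\<^sup>4)\<close>: the powers \<open>k\<^sup>6\<close> and \<open>k\<^sup>4\<close> fix \<open>q\<close> and \<open>p\<close>, the power \<open>k\<^sup>2\<close> fixes \<open>c\<close>,
  and the constant term is the condition on \<open>s\<close>. Leaving \<open>k = 0\<close> aside costs only a constant
  of integration, so differentiating yields the Kawahara equation.

  For existence, put \<open>r = \<alpha> / \<beta>\<close>. The condition equates a positive constant with a
  positive multiple of \<open>\<Sum>k\<ge>1. k\<^sup>3 (13 k\<^sup>2 + r) / (exp (2 pi k / s) - 1)\<close>. All terms are positive,
  the sum is at most linear in \<open>s\<close> near \<open>0\<close> and is unbounded as \<open>s\<close> grows, so the intermediate value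
  theorem applies.\<close>

section \<open>Cosine series with rapidly decreasing coefficients\<close>

text \<open>For real terms, unconditional summability is absolute, so all moments converge
  absolutely.\<close>

definition rapidly_decreasing :: "(int \<Rightarrow> real) \<Rightarrow> bool" where
  "rapidly_decreasing c \<longleftrightarrow> (\<forall>m. (\<lambda>k. c k * of_int k ^ m) summable_on UNIV)"

text \<open>The order \<open>m\<close> counts derivatives; each of them multiplies by \<open>k\<close> and shifts the phase by
  \<open>pi / 2\<close>.\<close>

definition cos_series :: "(int \<Rightarrow> real) \<Rightarrow> nat \<Rightarrow> real \<Rightarrow> real" where
  "cos_series c m x = (\<Sum>\<^sub>\<infinity>k. c k * of_int k ^ m * cos (of_int k * x + real m * (pi / 2)))"

section \<open>Criteria for rapid decrease\<close>

lemma summable_on_intI: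
  fixes f :: "int \<Rightarrow> real"
  assumes "summable (\<lambda>n. \<bar>f (int n)\<bar>)" and "summable (\<lambda>n. \<bar>f (- int n)\<bar>)"
  shows "f summable_on UNIV"
proof -
  have "f summable_on range int"
    using assms(1) by (subst summable_on_reindex) (auto simp: o_def intro: norm_summable_imp_summable_on)
  moreover have "f summable_on range (\<lambda>n. - int n)"
    using assms(2) by (subst summable_on_reindex)
      (auto simp: o_def inj_on_def intro: norm_summable_imp_summable_on)
  ultimately have "f summable_on (range int \<union> range (\<lambda>n. - int n))"
    by (rule summable_on_union)
  moreover have "range int \<union> range (\<lambda>n. - int n) = UNIV"
  proof -
    have "k \<in> range int \<union> range (\<lambda>n. - int n)" for k
      by (cases k rule: int_cases2) auto
    then show ?thesis by auto
  qed
  ultimately show ?thesis by simp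
qed

text \<open>A bound of order \<open>m + 2\<close> allows comparison of the order \<open>m\<close>
  with inverse squares.\<close>

lemma rapidly_decreasingI:
  assumes sym: "\<And>k. \<bar>c (- k)\<bar> = \<bar>c k\<bar>"
    and bound: "\<And>m. \<exists>K. \<forall>n>0. \<bar>c (int n)\<bar> * real n ^ m \<le> K"
  shows "rapidly_decreasing c"
  unfolding rapidly_decreasing_def
proof
  fix m
  obtain K where K: "\<And>n. n > 0 \<Longrightarrow> \<bar>c (int n)\<bar> * real n ^ (m + 2) \<le> K"
    using bound[of "m + 2"] by blast
  have *: "summable (\<lambda>n. \<bar>c (int n)\<bar> * real n ^ m)"
  proof (rule summable_comparison_test')
    show "summable (\<lambda>n. K * inverse (real n ^ 2))"
      by (intro summable_mult inverse_power_summable) simp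
    fix n :: nat assume "n \<ge> 1"
    then show "norm (\<bar>c (int n)\<bar> * real n ^ m) \<le> K * inverse (real n ^ 2)"
      using K[of n] by (simp add: field_simps power2_eq_square)
  qed
  show "(\<lambda>k. c k * of_int k ^ m) summable_on UNIV"
    by (rule summable_on_intI) (use * in \<open>simp_all add: abs_mult power_abs sym\<close>)
qed

text \<open>Keeps only the terms \<open>0\<close> and \<open>m\<close> of the exponential series;
  they are distinct because \<open>m > 0\<close>.\<close>

lemma power_le_exp_minus_1:
  fixes y :: real
  assumes "y \<ge> 0" "m > 0"
  shows "y ^ m \<le> fact m * (exp y - 1)"
proof -
  have s: "(\<lambda>n. y ^ n /\<^sub>R fact n) sums exp y" by (rule exp_converges)
  have "(\<Sum>n\<in>{0, m}. y ^ n /\<^sub>R fact n) \<le> (\<Sum>n. y ^ n /\<^sub>R fact n)"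
    by (rule sum_le_suminf[OF sums_summable[OF s]]) (simp_all add: assms)
  then have "1 + y ^ m / fact m \<le> exp y"
    unfolding sums_unique[OF s, symmetric] using assms by (simp add: field_simps)
  then show ?thesis by (simp add: field_simps)
qed

lemma bose_moment_bound:
  fixes y :: real
  assumes "y > 0"
  obtains K where "\<And>n. n > 0 \<Longrightarrow> real n ^ m / (exp (y * real n) - 1) \<le> K"
proof
  fix n :: nat assume n: "n > 0"
  have e: "exp (y * real n) - 1 > 0" using assms n by simp
  \<comment> \<open>Raising the order by one makes the exponent positive even for
    \<open>m = 0\<close>, as \<open>power_le_exp_minus_1\<close> requires.\<close>
  have "real n ^ m * y ^ (m+1) \<le> real n ^ (m+1) * y ^ (m+1)"
    using n assms by (intro mult_right_mono power_increasing) auto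
  also have "\<dots> = (y * real n) ^ (m+1)" by (simp add: power_mult_distrib algebra_simps)
  also have "\<dots> \<le> fact (m+1) * (exp (y * real n) - 1)"
    by (rule power_le_exp_minus_1) (use assms in auto)
  finally have "real n ^ m * y ^ (m+1) \<le> fact (m+1) * (exp (y * real n) - 1)" .
  then show "real n ^ m / (exp (y * real n) - 1) \<le> fact (m+1) / y ^ (m+1)"
    using e assms by (simp add: divide_le_eq le_divide_eq field_simps del: fact_Suc)
qed

lemma abs_mult_le_abs:
  fixes a b :: real
  shows "\<bar>b\<bar> \<le> 1 \<Longrightarrow> \<bar>a * b\<bar> \<le> \<bar>a\<bar>"
  by (simp add: abs_mult mult_left_le)

lemma rapidly_decreasing_norm_summable:
  assumes "rapidly_decreasing c"
  shows "(\<lambda>k. norm (c k * of_int k ^ m)) summable_on UNIV"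
  using assms[unfolded rapidly_decreasing_def, rule_format, of m]
  by (rule summable_on_iff_abs_summable_on_real[THEN iffD1])

lemma norm_summable_on_imp_summable_on_real:
  "(\<lambda>k. norm (f k :: real)) summable_on A \<Longrightarrow> f summable_on A"
  by (rule summable_on_iff_abs_summable_on_real[THEN iffD2])

section \<open>Termwise differentiation\<close>

context
  fixes c :: "int \<Rightarrow> real"
  assumes rd: "rapidly_decreasing c"
begin

lemma cos_series_summable:
  "(\<lambda>k. c k * of_int k ^ m * cos (of_int k * x + real m * (pi / 2))) summable_on UNIV"
proof -
  have "(\<lambda>k. norm (c k * of_int k ^ m)) summable_on UNIV"
    using rd by (rule rapidly_decreasing_norm_summable)
  then have "(\<lambda>k. norm (c k * of_int k ^ m * cos (of_int k * x + real m * (pi / 2)))) summable_on UNIV"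
    by (rule Infinite_Sum.abs_summable_on_comparison_test')
      (unfold real_norm_def, rule abs_mult_le_abs, simp)
  then show ?thesis by (rule norm_summable_on_imp_summable_on_real)
qed

text \<open>Enumerating the integers by \<open>int_decode\<close> gives an ordinary series. The
  absolute moment of order \<open>m + 1\<close> dominates the differentiated terms uniformly in
  \<open>x\<close>, so the Weierstrass test applies.\<close>

lemma cos_series_has_derivative:
  "(cos_series c m has_real_derivative cos_series c (Suc m) x) (at x)"
proof -
  define f where "f m n x = c (int_decode n) * of_int (int_decode n) ^ m *
    cos (of_int (int_decode n) * x + real m * (pi / 2))" for m n x
  have sm: "(\<lambda>n. f m n x) summable_on UNIV" for m x
    using cos_series_summable[of m x] summable_on_reindex_bij_betw[OF bij_int_decode,
        of "\<lambda>k. c k * of_int k ^ m * cos (of_int k * x + real m * (pi / 2))"]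
    by (simp add: f_def)
  have inf: "infsum (\<lambda>n. f m n x) UNIV = cos_series c m x" for m x
    unfolding f_def cos_series_def
    by (rule infsum_reindex_bij_betw[OF bij_int_decode,
        of "\<lambda>k. c k * of_int k ^ m * cos (of_int k * x + real m * (pi / 2))"])
  have sums: "(\<lambda>n. f m n x) sums cos_series c m x" for m x
    using has_sum_imp_sums[OF has_sum_infsum[OF sm]] by (simp add: inf)
  have M: "summable (\<lambda>n. \<bar>c (int_decode n) * of_int (int_decode n) ^ Suc m\<bar>)"
  proof -
    have "(\<lambda>k. norm (c k * of_int k ^ Suc m)) summable_on UNIV"
      using rd by (rule rapidly_decreasing_norm_summable)
    then have "(\<lambda>n. norm (c (int_decode n) * of_int (int_decode n) ^ Suc m)) summable_on UNIV"
      using summable_on_reindex_bij_betw[OF bij_int_decode, of "\<lambda>k. norm (c k * of_int k ^ Suc m)"]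
      by (rule iffD2[rotated])
    then show ?thesis unfolding real_norm_def by (rule summable_on_imp_summable)
  qed
  have "((\<lambda>x. \<Sum>n. f m n x) has_field_derivative (\<Sum>n. f (Suc m) n x)) (at x)"
  proof (rule has_field_derivative_series'(2)[of UNIV])
    show "(f m n has_field_derivative f (Suc m) n x) (at x within UNIV)" for n x
    proof -
      define k a where "k = real_of_int (int_decode n)" and "a = real m * (pi / 2)"
      have "k * x + real (Suc m) * (pi / 2) = (k * x + a) + pi / 2"
        by (simp add: a_def algebra_simps add_divide_distrib)
      then have cos: "cos (k * x + real (Suc m) * (pi / 2)) = - sin (k * x + a)"
        by (simp only: cos_add) simp
      have "((\<lambda>x. C * cos (k * x + a)) has_field_derivative C * (- sin (k * x + a) * k)) (at x)" for C
        by (auto intro!: derivative_eq_intros)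
      from this[of "c (int_decode n) * k ^ m"] show ?thesis
        unfolding f_def k_def[symmetric] a_def[symmetric] cos by (simp add: mult_ac)
    qed
    show "uniformly_convergent_on UNIV (\<lambda>n x. \<Sum>i<n. f (Suc m) i x)"
      by (rule Weierstrass_m_test'[OF _ M])
        (unfold f_def real_norm_def, rule abs_mult_le_abs, simp)
    show "summable (\<lambda>n. f m n x)" using sums by (simp add: sums_iff)
  qed auto
  then show ?thesis using sums by (simp add: sums_iff)
qed

lemma deriv_funpow_cos_series: "(deriv ^^ n) (cos_series c 0) = cos_series c n"
  by (induction n) (auto intro!: DERIV_imp_deriv cos_series_has_derivative)

lemma deriv_funpow_cos_series_shift:
  "(deriv ^^ n) (\<lambda>y. cos_series c 0 (y - a)) = (\<lambda>y. cos_series c n (y - a))"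
proof (induction n)
  case (Suc n)
  have "((\<lambda>y. cos_series c n (y - a)) has_real_derivative cos_series c (Suc n) (y - a)) (at y)" for y
    by (rule DERIV_chain2[OF cos_series_has_derivative, of "\<lambda>y. y - a" 1 y UNIV n, simplified])
      (auto intro!: derivative_eq_intros)
  then show ?case using Suc by (auto intro!: DERIV_imp_deriv)
qed simp

end

section \<open>Periodicity, parity and squares\<close>

lemma cos_series_periodic: "cos_series d m (x + 2 * pi) = cos_series d m x"
proof -
  have "cos (of_int k * (x + 2 * pi) + a) = cos (of_int k * x + a)" for k :: int and a
  proof -
    have "of_int k * (x + 2 * pi) + a = (of_int k * x + a) + 2 * pi * of_int k"
      by (simp add: algebra_simps)
    then show ?thesis by (simp only: cos_add cos_int_2pin sin_int_2pin) simp
  qed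
  then show ?thesis by (simp add: cos_series_def)
qed

lemma infsum_int_odd:
  fixes f :: "int \<Rightarrow> real"
  assumes "\<And>k. f (- k) = - f k"
  shows "infsum f UNIV = 0"
proof -
  have "infsum f UNIV = (\<Sum>\<^sub>\<infinity>k. f (- k))"
    by (rule infsum_reindex_bij_betw[symmetric, OF bij_uminus])
  also have "\<dots> = - infsum f UNIV" by (simp add: assms infsum_uminus)
  finally show ?thesis by simp
qed

text \<open>Passes from sums over all integers to series over \<open>k >= 1\<close>, the form in
  which \<open>e2\<close>, \<open>e4\<close> and \<open>e6\<close> are given.\<close>

lemma infsum_int_even:
  fixes f :: "int \<Rightarrow> real"
  assumes f: "f summable_on UNIV" and even: "\<And>k. f (- k) = f k" and "f 0 = 0"
  shows "(\<lambda>n. f (int (Suc n))) sums (infsum f UNIV / 2)"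
proof -
  define N P where "N = range (\<lambda>n. - int (Suc n))" and "P = range (\<lambda>n. int (Suc n))"
  have fP: "f summable_on P" using f by (rule summable_on_subset_banach) simp
  have fN: "f summable_on N" using f by (rule summable_on_subset_banach) simp
  have P: "infsum f P = (\<Sum>\<^sub>\<infinity>n. f (int (Suc n)))"
    unfolding P_def by (subst infsum_reindex) (simp_all add: o_def inj_on_def)
  have N: "infsum f N = (\<Sum>\<^sub>\<infinity>n. f (int (Suc n)))"
    unfolding N_def by (subst infsum_reindex) (simp_all add: o_def inj_on_def even del: of_nat_Suc)
  have "infsum f UNIV = infsum f (N \<union> P)"
  proof (rule infsum_cong_neutral)
    fix k assume "k \<in> UNIV - (N \<union> P)"
    then have "k = 0" unfolding N_def P_def
      by (cases k rule: int_cases3) (auto simp: image_iff dest!: gr0_implies_Suc)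
    then show "f k = 0" by (simp add: assms)
  qed auto
  also have "\<dots> = infsum f N + infsum f P"
    by (rule infsum_Un_disjoint[OF fN fP]) (auto simp: N_def P_def)
  finally have "infsum f UNIV / 2 = (\<Sum>\<^sub>\<infinity>n. f (int (Suc n)))" by (simp add: N P)
  moreover have "(\<lambda>n. f (int (Suc n))) summable_on UNIV"
    using fP unfolding P_def by (subst (asm) summable_on_reindex) (simp_all add: o_def inj_on_def)
  ultimately show ?thesis using has_sum_imp_sums[OF has_sum_infsum] by metis
qed

text \<open>A Cauchy product: absolute convergence allows summation along \<open>j + l = k\<close>.
  Replacing \<open>cos (j x) * cos (l x)\<close> by \<open>cos ((j + l) x)\<close> changes each term
  by a multiple of \<open>sin (j x) * sin (l x)\<close>, and for even coefficients these sum over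
  \<open>l\<close> to 0.\<close>

lemma cos_series_square:
  assumes rd: "rapidly_decreasing c" and even: "\<And>k. c (- k) = c k"
  shows "cos_series c 0 x ^ 2 = (\<Sum>\<^sub>\<infinity>k. (\<Sum>\<^sub>\<infinity>j. c j * c (k - j)) * cos (of_int k * x))"
proof -
  have c: "(\<lambda>k. \<bar>c k\<bar>) summable_on UNIV"
    using rapidly_decreasing_norm_summable[OF rd, of 0] by simp
  have cs: "(\<lambda>k. c k * F k) summable_on UNIV" if "\<And>k. \<bar>F k\<bar> \<le> 1" for F
  proof -
    have "(\<lambda>k. norm (c k * F k)) summable_on UNIV"
      using c by (rule Infinite_Sum.abs_summable_on_comparison_test') (simp add: abs_mult_le_abs that)
    then show ?thesis by (rule norm_summable_on_imp_summable_on_real)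
  qed
  have cc: "(\<lambda>(j, l). \<bar>c j\<bar> * \<bar>c l\<bar>) summable_on UNIV \<times> UNIV"
  proof -
    have "(\<lambda>p. norm (case p of (j, l) \<Rightarrow> c j * c l)) summable_on UNIV \<times> UNIV"
      using c by (subst Infinite_Sum.abs_summable_on_Sigma_iff)
        (simp add: abs_mult infsum_cmult_right' summable_on_cmult_left summable_on_cmult_right)
    then show ?thesis by (simp add: abs_mult case_prod_unfold)
  qed
  have ccF: "(\<lambda>(j, l). c j * c l * F j l) summable_on UNIV \<times> UNIV" if "\<And>j l. \<bar>F j l\<bar> \<le> 1" for F
  proof -
    have "(\<lambda>p. norm (case p of (j, l) \<Rightarrow> c j * c l * F j l)) summable_on UNIV \<times> UNIV"
      using cc by (rule Infinite_Sum.abs_summable_on_comparison_test') (use that in \<open>auto simp: abs_mult_le_abs simp flip: abs_mult\<close>)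
    then show ?thesis by (rule norm_summable_on_imp_summable_on_real)
  qed
  define h :: "int \<times> int \<Rightarrow> int \<times> int" where "h = (\<lambda>(k, j). (j, k - j))"
  have h: "bij_betw h (UNIV \<times> UNIV) (UNIV \<times> UNIV)"
    by (rule bij_betw_byWitness[where f' = "\<lambda>(j, l). (j + l, j)"]) (auto simp: h_def)
  let ?C = "\<lambda>k x. cos (of_int k * x)"
  have S2: "(\<lambda>(k, j). c j * c (k - j) * ?C k x) summable_on UNIV \<times> UNIV"
    using summable_on_reindex_bij_betw[OF h, of "\<lambda>(j, l). c j * c l * ?C (j + l) x"]
      ccF[of "\<lambda>j l. ?C (j + l) x"]
    by (simp add: h_def case_prod_unfold)
  have inner: "(\<Sum>\<^sub>\<infinity>j. c j * c (k - j) * ?C k x) = (\<Sum>\<^sub>\<infinity>j. c j * c (k - j)) * ?C k x" for k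
    by (rule infsum_cmult_left')
  have odd: "(\<Sum>\<^sub>\<infinity>l. c l * sin (of_int l * x)) = 0"
    by (rule infsum_int_odd) (simp add: even)
  have row: "(\<Sum>\<^sub>\<infinity>l. c j * c l * ?C (j + l) x) = cos_series c 0 x * (c j * ?C j x)" for j
  proof -
    have "(\<Sum>\<^sub>\<infinity>l. c j * c l * ?C (j + l) x)
        = (\<Sum>\<^sub>\<infinity>l. c j * ?C j x * (c l * ?C l x) + (- c j * sin (of_int j * x)) * (c l * sin (of_int l * x)))"
      by (rule infsum_cong) (simp add: distrib_right cos_add algebra_simps)
    also have "\<dots> = (\<Sum>\<^sub>\<infinity>l. c j * ?C j x * (c l * ?C l x)) +
        (\<Sum>\<^sub>\<infinity>l. (- c j * sin (of_int j * x)) * (c l * sin (of_int l * x)))"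
      by (intro infsum_add summable_on_cmult_right cs abs_cos_le_one abs_sin_le_one)
    also have "\<dots> = c j * ?C j x * cos_series c 0 x"
      by (simp only: infsum_cmult_right' odd cos_series_def) simp
    finally show ?thesis by (simp add: algebra_simps)
  qed
  have "cos_series c 0 x ^ 2 = cos_series c 0 x * (\<Sum>\<^sub>\<infinity>j. c j * ?C j x)"
    by (simp add: power2_eq_square cos_series_def)
  also have "\<dots> = (\<Sum>\<^sub>\<infinity>j. \<Sum>\<^sub>\<infinity>l. c j * c l * ?C (j + l) x)"
    by (simp only: row infsum_cmult_right')
  also have "\<dots> = infsum (\<lambda>(j, l). c j * c l * ?C (j + l) x) (UNIV \<times> UNIV)"
    by (rule infsum_Sigma'_banach) (use ccF[of "\<lambda>j l. ?C (j + l) x"] in simp)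
  also have "\<dots> = infsum (\<lambda>(k, j). c j * c (k - j) * ?C k x) (UNIV \<times> UNIV)"
    using infsum_reindex_bij_betw[OF h, of "\<lambda>(j, l). c j * c l * ?C (j + l) x"]
    by (simp add: h_def case_prod_unfold)
  also have "\<dots> = (\<Sum>\<^sub>\<infinity>k. \<Sum>\<^sub>\<infinity>j. c j * c (k - j) * ?C k x)"
    by (rule infsum_Sigma'_banach[symmetric]) (use S2 in simp)
  finally show "cos_series c 0 x ^ 2 = (\<Sum>\<^sub>\<infinity>k. (\<Sum>\<^sub>\<infinity>j. c j * c (k - j)) * ?C k x)"
    by (simp add: inner)
qed

section \<open>The convolution square of the coefficients\<close>

text \<open>At \<open>j = 0\<close> the quotient is \<open>1 / 0 = 0\<close>, so that \<open>coth_excess h\<close> is odd on all integers.\<close>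

definition coth_excess :: "real \<Rightarrow> int \<Rightarrow> real" where
  "coth_excess h j = cosh (h * of_int j) / sinh (h * of_int j) - of_int (sgn j)"

lemma coth_excess_minus: "coth_excess h (- j) = - coth_excess h j"
  by (simp add: coth_excess_def)

lemma coth_excess_0: "coth_excess h 0 = 0"
  by (simp add: coth_excess_def)

text \<open>Twice a Bose-Einstein factor: this yields both the exponential decay and the terms of
  \<open>e2\<close>, \<open>e4\<close> and \<open>e6\<close>.\<close>

lemma coth_excess_pos:
  assumes "h > 0" "n > 0"
  shows "coth_excess h (int n) = 2 / (exp (2 * h * real n) - 1)"
proof -
  define y where "y = h * real n"
  have y: "y > 0" using assms by (simp add: y_def)
  have 1: "exp y > 1" using y by simp
  then have W: "exp y * exp y > 1" by (rule less_1_mult[OF _ 1])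
  have "exp y + inverse (exp y) = (exp y * exp y + 1) / exp y"
    and "exp y - inverse (exp y) = (exp y * exp y - 1) / exp y"
    by (simp_all add: field_simps)
  then have "(exp y + inverse (exp y)) / (exp y - inverse (exp y)) - 1 = 2 / (exp y * exp y - 1)"
    using W by (simp add: divide_simps)
  moreover have "exp (2 * h * real n) = exp y * exp y"
    by (simp add: y_def mult_ac flip: exp_add)
  moreover have "coth_excess h (int n) = (exp y + inverse (exp y)) / (exp y - inverse (exp y)) - 1"
    using assms by (simp add: coth_excess_def cosh_def sinh_def y_def exp_minus divide_simps)
  ultimately show ?thesis by simp
qed

section \<open>Rapid decrease of the coefficients\<close>

lemma rapidly_decreasing_coth_excess:
  assumes "h > 0"
  shows "rapidly_decreasing (coth_excess h)"
proof (rule rapidly_decreasingI)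
  show "\<bar>coth_excess h (- k)\<bar> = \<bar>coth_excess h k\<bar>" for k by (simp add: coth_excess_minus)
  fix m
  obtain K where K: "\<And>n. n > 0 \<Longrightarrow> real n ^ m / (exp (2 * h * real n) - 1) \<le> K"
    using bose_moment_bound[of "2 * h" m] assms by auto
  show "\<exists>K. \<forall>n>0. \<bar>coth_excess h (int n)\<bar> * real n ^ m \<le> K"
  proof (intro exI allI impI)
    fix n :: nat assume n: "n > 0"
    have "exp (2 * h * real n) - 1 > 0" using n assms by simp
    then show "\<bar>coth_excess h (int n)\<bar> * real n ^ m \<le> 2 * K"
      using K[OF n] by (simp add: coth_excess_pos[OF assms n] field_simps)
  qed
qed

lemma rapidly_decreasing_u_coeff:
  assumes "s > 0"
  shows "rapidly_decreasing (u_coeff s)"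
proof (rule rapidly_decreasingI)
  show "\<bar>u_coeff s (- k)\<bar> = \<bar>u_coeff s k\<bar>" for k by (simp add: u_coeff_def)
  fix m
  have h: "pi / s > 0" using assms by simp
  \<comment> \<open>The numerator of \<open>u_coeff\<close> raises the order by one; the denominator
    is handled by \<open>sinh y >= (exp y - 1) / 2\<close> for \<open>y > 0\<close>.\<close>
  obtain K where K: "\<And>n. n > 0 \<Longrightarrow> real n ^ Suc m / (exp (pi / s * real n) - 1) \<le> K"
    using bose_moment_bound[OF h, of "Suc m"] by blast
  show "\<exists>K. \<forall>n>0. \<bar>u_coeff s (int n)\<bar> * real n ^ m \<le> K"
  proof (intro exI allI impI)
    fix n :: nat assume n: "n > 0"
    define y where "y = pi / s * real n"
    have y: "y > 0" unfolding y_def by (rule mult_pos_pos) (use h n in auto)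
    have "exp (- y) \<le> 1" using y by simp
    then have "(exp y - 1) / 2 \<le> sinh y" by (simp add: sinh_def)
    moreover have "0 < exp y - 1" using y by simp
    ultimately have "real n ^ Suc m / sinh y \<le> real n ^ Suc m / ((exp y - 1) / 2)"
      by (intro divide_left_mono) auto
    also have "\<dots> = 2 * (real n ^ Suc m / (exp y - 1))" by simp
    also have "\<dots> \<le> 2 * K" using K[OF n] by (simp add: y_def)
    finally show "\<bar>u_coeff s (int n)\<bar> * real n ^ m \<le> 2 * K"
      using n y by (simp add: u_coeff_def y_def mult_ac)
  qed
qed

lemma rapidly_decreasing_quadratic_mult:
  assumes "rapidly_decreasing c"
  shows "rapidly_decreasing (\<lambda>k. (p + q * of_int k ^ 2) * c k)"
  unfolding rapidly_decreasing_def
proof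
  fix m
  have "(\<lambda>k. p * (c k * of_int k ^ m) + q * (c k * of_int k ^ (m + 2))) summable_on UNIV"
    using assms unfolding rapidly_decreasing_def
    by (intro summable_on_add summable_on_cmult_right) blast+
  then show "(\<lambda>k. (p + q * of_int k ^ 2) * c k * of_int k ^ m) summable_on UNIV"
    by (simp add: algebra_simps power_add power2_eq_square)
qed

section \<open>Moments of the coth remainder and power sums\<close>

lemma coth_excess_moment_even:
  "even m \<Longrightarrow> (\<Sum>\<^sub>\<infinity>j. coth_excess h j * of_int j ^ m) = 0"
  by (rule infsum_int_odd) (simp add: coth_excess_minus)

text \<open>The factor 4 combines the 2 of \<open>coth_excess_pos\<close> with the folding of the
  integers onto \<open>k >= 1\<close>; the sign comes from \<open>1 - exp\<close> in place of
  \<open>exp - 1\<close>.\<close>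

lemma coth_excess_moment_odd:
  assumes "s > 0" "odd m"
  shows "(\<lambda>n. real (Suc n) ^ m / (1 - exp (2 * pi * real (Suc n) / s))) sums
    - ((\<Sum>\<^sub>\<infinity>j. coth_excess (pi / s) j * of_int j ^ m) / 4)"
proof -
  have h: "pi / s > 0" using assms by simp
  have eq: "- (coth_excess (pi / s) (int (Suc n)) * of_int (int (Suc n)) ^ m) / 2 =
    real (Suc n) ^ m / (1 - exp (2 * pi * real (Suc n) / s))" for n
  proof -
    have "exp (2 * pi * real (Suc n) / s) > 1" using assms by simp
    moreover have "- (2 / (X - 1) * R) / 2 = R / (1 - X)" if "X > 1" for X R :: real
      using that by (simp add: field_simps)
    moreover have "2 * (pi / s) * real (Suc n) = 2 * pi * real (Suc n) / s" by simp
    ultimately show ?thesis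
      using coth_excess_pos[OF h, of "Suc n"] by (simp only: of_int_of_nat_eq)
  qed
  have "(\<lambda>j. coth_excess (pi / s) j * of_int j ^ m) summable_on UNIV"
    using rapidly_decreasing_coth_excess[OF h] by (simp add: rapidly_decreasing_def)
  from infsum_int_even[OF this]
  have "(\<lambda>n. coth_excess (pi / s) (int (Suc n)) * of_int (int (Suc n)) ^ m) sums
      ((\<Sum>\<^sub>\<infinity>j. coth_excess (pi / s) j * of_int j ^ m) / 2)"
    using assms by (simp add: coth_excess_minus coth_excess_0)
  from sums_divide[OF sums_minus[OF this], of 2] show ?thesis
    unfolding eq by simp
qed

lemma coth_excess_moments:
  assumes "s > 0"
  shows "(\<Sum>\<^sub>\<infinity>j. coth_excess (pi / s) j * of_int j) = 1 / 6 - e2 s"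
    and "(\<Sum>\<^sub>\<infinity>j. coth_excess (pi / s) j * of_int j ^ 3) = - 1 / 60 - e4 s"
    and "(\<Sum>\<^sub>\<infinity>j. coth_excess (pi / s) j * of_int j ^ 5) = 1 / 126 - e6 s"
  using coth_excess_moment_odd[OF assms, of 1, THEN sums_unique]
    coth_excess_moment_odd[OF assms, of 3, THEN sums_unique]
    coth_excess_moment_odd[OF assms, of 5, THEN sums_unique]
  by (simp_all add: e2_def e4_def e6_def del: of_nat_Suc)

lemma power_sums:
  shows "(\<Sum>j\<le>n. real j) = real n * (real n + 1) / 2"
    and "(\<Sum>j\<le>n. real j ^ 2) = real n * (real n + 1) * (2 * real n + 1) / 6"
    and "(\<Sum>j\<le>n. real j ^ 3) = real n ^ 2 * (real n + 1) ^ 2 / 4"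
    and "(\<Sum>j\<le>n. real j ^ 4) =
      real n * (real n + 1) * (2 * real n + 1) * (3 * real n ^ 2 + 3 * real n - 1) / 30"
    and "(\<Sum>j\<le>n. real j ^ 5) =
      real n ^ 2 * (real n + 1) ^ 2 * (2 * real n ^ 2 + 2 * real n - 1) / 12"
    and "(\<Sum>j\<le>n. real j ^ 6) = real n * (real n + 1) * (2 * real n + 1) *
      (3 * real n ^ 4 + 6 * real n ^ 3 - 3 * real n + 1) / 42"
  by (induction n; simp add: field_simps eval_nat_numeral)+

section \<open>Convolution for a quadratic Fourier multiplier\<close>

locale quadratic_multiplier =
  fixes s p q :: real
  assumes s: "s > 0"
begin

text \<open>The factor \<open>p + q k^2\<close> is the Fourier symbol of the operator
  \<open>p - q (d/dx)^2\<close>.\<close>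

definition V :: "int \<Rightarrow> real" where
  "V k = (p + q * of_int k ^ 2) * u_coeff s k"

text \<open>For \<open>j\<close> other than \<open>0\<close> and \<open>k\<close>, the numerator of
  \<open>V j * V (k - j)\<close> over the two sinh factors.\<close>

definition P :: "real \<Rightarrow> real \<Rightarrow> real" where
  "P k j = j * (k - j) * (p + q * j ^ 2) * (p + q * (k - j) ^ 2)"

lemma P_expand:
  "P k j = (p\<^sup>2 * k + p * q * k ^ 3) * j - (p\<^sup>2 + 3 * p * q * k\<^sup>2) * j ^ 2
     + (4 * p * q * k + q\<^sup>2 * k ^ 3) * j ^ 3 - (2 * p * q + 3 * q\<^sup>2 * k\<^sup>2) * j ^ 4
     + 3 * q\<^sup>2 * k * j ^ 5 - q\<^sup>2 * j ^ 6"
  unfolding P_def by algebra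

text \<open>The contribution of the sign functions. Only the leading powers survive later: the lower
  ones cancel against the constants 1/6, -1/60 and 1/126 of \<open>e2\<close>, \<open>e4\<close> and
  \<open>e6\<close>.\<close>

lemma sum_P:
  "(\<Sum>j\<le>n. P (real n) (real j)) = p\<^sup>2 * (real n ^ 3 - real n) / 6
     + p * q * (real n ^ 5 / 10 - real n ^ 3 / 6 + real n / 15)
     + q\<^sup>2 * (real n ^ 7 / 140 + real n ^ 3 / 60 - real n / 42)"
  unfolding P_expand sum.distrib sum_subtractf sum_distrib_left[symmetric] power_sums
  by (simp add: field_simps eval_nat_numeral)

text \<open>The excess is odd, so only the odd powers of \<open>j\<close> in \<open>P_expand\<close>
  contribute.\<close>

lemma has_sum_P_coth_excess:
  "((\<lambda>j. P k (of_int j) * coth_excess (pi / s) j) has_sum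
     ((p\<^sup>2 * k + p * q * k ^ 3) * (1 / 6 - e2 s) + (4 * p * q * k + q\<^sup>2 * k ^ 3) * (- 1 / 60 - e4 s)
      + 3 * q\<^sup>2 * k * (1 / 126 - e6 s))) UNIV"
proof -
  let ?g = "coth_excess (pi / s)"
  have "rapidly_decreasing ?g" using s by (intro rapidly_decreasing_coth_excess) simp
  then have sm: "((\<lambda>j. ?g j * of_int j ^ m) has_sum (\<Sum>\<^sub>\<infinity>j. ?g j * of_int j ^ m)) UNIV" for m
    unfolding rapidly_decreasing_def by (simp add: has_sum_infsum)
  have 1: "((\<lambda>j. ?g j * of_int j) has_sum (1 / 6 - e2 s)) UNIV"
    and 2: "((\<lambda>j. ?g j * of_int j ^ 2) has_sum 0) UNIV"
    and 3: "((\<lambda>j. ?g j * of_int j ^ 3) has_sum (- 1 / 60 - e4 s)) UNIV"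
    and 4: "((\<lambda>j. ?g j * of_int j ^ 4) has_sum 0) UNIV"
    and 5: "((\<lambda>j. ?g j * of_int j ^ 5) has_sum (1 / 126 - e6 s)) UNIV"
    and 6: "((\<lambda>j. ?g j * of_int j ^ 6) has_sum 0) UNIV"
    using sm[of 1] sm[of 2] sm[of 3] sm[of 4] sm[of 5] sm[of 6]
    by (simp_all add: coth_excess_moments[OF s] coth_excess_moment_even)
  have "((\<lambda>j. (p\<^sup>2 * k + p * q * k ^ 3) * (?g j * of_int j)
      + (- (p\<^sup>2 + 3 * p * q * k\<^sup>2)) * (?g j * of_int j ^ 2)
      + (4 * p * q * k + q\<^sup>2 * k ^ 3) * (?g j * of_int j ^ 3)
      + (- (2 * p * q + 3 * q\<^sup>2 * k\<^sup>2)) * (?g j * of_int j ^ 4)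
      + 3 * q\<^sup>2 * k * (?g j * of_int j ^ 5) + (- q\<^sup>2) * (?g j * of_int j ^ 6)) has_sum
     ((p\<^sup>2 * k + p * q * k ^ 3) * (1 / 6 - e2 s) + (- (p\<^sup>2 + 3 * p * q * k\<^sup>2)) * 0
      + (4 * p * q * k + q\<^sup>2 * k ^ 3) * (- 1 / 60 - e4 s)
      + (- (2 * p * q + 3 * q\<^sup>2 * k\<^sup>2)) * 0
      + 3 * q\<^sup>2 * k * (1 / 126 - e6 s) + (- q\<^sup>2) * 0)) UNIV"
    by (intro has_sum_add has_sum_cmult_right 1 2 3 4 5 6)
  moreover have "P k (of_int j) * ?g j = (p\<^sup>2 * k + p * q * k ^ 3) * (?g j * of_int j)
      + (- (p\<^sup>2 + 3 * p * q * k\<^sup>2)) * (?g j * of_int j ^ 2)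
      + (4 * p * q * k + q\<^sup>2 * k ^ 3) * (?g j * of_int j ^ 3)
      + (- (2 * p * q + 3 * q\<^sup>2 * k\<^sup>2)) * (?g j * of_int j ^ 4)
      + 3 * q\<^sup>2 * k * (?g j * of_int j ^ 5) + (- q\<^sup>2) * (?g j * of_int j ^ 6)" for j
    unfolding P_expand by algebra
  ultimately show ?thesis by simp
qed

lemma V_minus: "V (- k) = V k"
  by (simp add: V_def u_coeff_def)

text \<open>\<open>P (of_int k)\<close> vanishes at \<open>0\<close> and \<open>k\<close>, so the two terms containing the constant coefficient
  \<open>s / pi\<close> appear separately.\<close>

lemma V_mult_V:
  assumes k: "k > 0"
  shows "V j * V (k - j) = P (of_int k) (of_int j) *
      (cosh (pi / s * of_int j) / sinh (pi / s * of_int j)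
       - cosh (pi / s * of_int (j - k)) / sinh (pi / s * of_int (j - k))) / sinh (pi / s * of_int k)
    + (if j \<in> {0, k} then p * (s / pi) * V k else 0)"
proof (cases "j \<in> {0, k}")
  case True
  then show ?thesis using k by (auto simp: P_def V_def u_coeff_def mult_ac)
next
  case False
  define x y where "x = pi / s * of_int j" and "y = pi / s * of_int (k - j)"
  have h: "pi / s > 0" using s by simp
  have xy: "x + y = pi / s * of_int k" "- y = pi / s * of_int (j - k)"
    using s by (simp_all add: x_def y_def field_simps)
  have nz: "sinh x \<noteq> 0" "sinh y \<noteq> 0"
    using False h by (auto simp: x_def y_def)
  have nz': "sinh (x + y) \<noteq> 0" unfolding xy using s k by simp
  have "1 / (sinh x * sinh y) = (cosh x / sinh x + cosh y / sinh y) / sinh (x + y)"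
  proof -
    have "cosh x / sinh x + cosh y / sinh y = sinh (x + y) / (sinh x * sinh y)"
      using nz by (simp add: sinh_add field_simps)
    then show ?thesis using nz' by simp
  qed
  \<comment> \<open>Oddness of coth gives both terms the form \<open>coth (h i)\<close>, at
    \<open>i = j\<close> and \<open>i = j - k\<close>, so that their difference telescopes.\<close>
  then have "1 / (sinh x * sinh y) = (cosh x / sinh x - cosh (- y) / sinh (- y)) / sinh (x + y)"
    by simp
  moreover have "V j * V (k - j) = P (of_int k) (of_int j) * (1 / (sinh x * sinh y))"
    using False by (simp add: V_def P_def u_coeff_def x_def y_def mult_ac)
  ultimately show ?thesis
    using False unfolding xy x_def[symmetric] by simp
qed

text \<open>A polynomial times a single coth is in general not summable. Splitting off the sign
  functions leaves pieces that converge separately: \<open>sg\<close>, \<open>g1\<close> and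
  \<open>g2\<close>.\<close>

lemma convolution_V_pos:
  assumes k: "k = int n" "n > 0"
  shows "(\<Sum>\<^sub>\<infinity>j. V j * V (k - j)) = u_coeff s k *
    (p\<^sup>2 * (k ^ 2 / 3 - 2 * e2 s) + p * q * (k ^ 4 / 5 - 8 * e4 s - 2 * k ^ 2 * e2 s)
      + q\<^sup>2 * (k ^ 6 / 70 - 2 * k ^ 2 * e4 s - 6 * e6 s) + 2 * (s / pi) * p * (p + q * k ^ 2))"
proof -
  let ?g = "coth_excess (pi / s)"
  let ?P = "\<lambda>j. P (of_int k) (of_int j)"
  define K where "K = real_of_int k"
  define G where "G = (p\<^sup>2 * K + p * q * K ^ 3) * (1 / 6 - e2 s)
    + (4 * p * q * K + q\<^sup>2 * K ^ 3) * (- 1 / 60 - e4 s) + 3 * q\<^sup>2 * K * (1 / 126 - e6 s)"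
  define S where "S = p\<^sup>2 * (K ^ 3 - K) / 6 + p * q * (K ^ 5 / 10 - K ^ 3 / 6 + K / 15)
     + q\<^sup>2 * (K ^ 7 / 140 + K ^ 3 / 60 - K / 42)"
  have kn: "real_of_int k = real n" using k by simp
  \<comment> \<open>The sign difference is 2 strictly between \<open>0\<close> and \<open>k\<close>
    and 0 outside; at the two endpoints it is 1, but \<open>P\<close> vanishes there.\<close>
  have sg: "((\<lambda>j. ?P j * (of_int (sgn j) - of_int (sgn (j - k)))) has_sum 2 * S) UNIV"
  proof -
    have "(\<Sum>j\<in>{0..k}. ?P j) = (\<Sum>i\<le>n. P (real n) (real i))"
      by (rule sum.reindex_bij_witness[of _ int nat]) (use k in auto)
    then have "(\<Sum>j\<in>{0..k}. 2 * ?P j) = 2 * S"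
      by (simp add: sum_P S_def K_def kn flip: sum_distrib_left)
    then have "((\<lambda>j. 2 * ?P j) has_sum 2 * S) {0..k}"
      using has_sum_finite[of "{0..k}" "\<lambda>j. 2 * ?P j"] by simp
    then show ?thesis
      by (rule iffD1[OF has_sum_cong_neutral, rotated 3]) (use k in \<open>auto simp: sgn_if P_def\<close>)
  qed
  have g1: "((\<lambda>j. ?P j * ?g j) has_sum G) UNIV"
    using has_sum_P_coth_excess[of "of_int k"] by (simp add: G_def K_def)
  \<comment> \<open>\<open>P k\<close> is invariant under \<open>j \<mapsto> k - j\<close>, so both shifts of the odd function \<open>?g\<close> contribute
    the same amount.\<close>
  have g2: "((\<lambda>j. - (?P j * ?g (j - k))) has_sum G) UNIV"
  proof -
    have "bij (\<lambda>j::int. k - j)" by (rule bij_betw_byWitness[where f' = "\<lambda>j. k - j"]) auto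
    then have "((\<lambda>j. ?P (k - j) * ?g (k - j)) has_sum G) UNIV"
      using g1 by (subst has_sum_reindex_bij_betw[where g = "\<lambda>j. k - j"])
    moreover have "?P (k - j) * ?g (k - j) = - (?P j * ?g (j - k))" for j
      using coth_excess_minus[of "pi / s" "j - k"] by (simp add: P_def mult_ac)
    ultimately show ?thesis by simp
  qed
  have "((\<lambda>j. if j \<in> {0, k} then p * (s / pi) * V k else 0) has_sum 2 * (p * (s / pi) * V k)) UNIV"
  proof -
    have "((\<lambda>j. p * (s / pi) * V k) has_sum 2 * (p * (s / pi) * V k)) {0, k}"
      using has_sum_finite[of "{0, k}" "\<lambda>j. p * (s / pi) * V k"] k by simp
    then show ?thesis
      by (rule iffD1[OF has_sum_cong_neutral, rotated 3]) auto
  qed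
  from has_sum_add[OF has_sum_cmult_left[OF has_sum_add[OF has_sum_add[OF sg g1] g2]] this]
  have "((\<lambda>j. (?P j * (of_int (sgn j) - of_int (sgn (j - k))) + ?P j * ?g j + - (?P j * ?g (j - k)))
      * (1 / sinh (pi / s * K)) + (if j \<in> {0, k} then p * (s / pi) * V k else 0)) has_sum
    ((2 * S + G + G) * (1 / sinh (pi / s * K)) + 2 * (p * (s / pi) * V k))) UNIV" .
  moreover have "(?P j * (of_int (sgn j) - of_int (sgn (j - k))) + ?P j * ?g j + - (?P j * ?g (j - k)))
      * (1 / sinh (pi / s * K)) + (if j \<in> {0, k} then p * (s / pi) * V k else 0)
      = V j * V (k - j)" for j
  proof -
    have "(T * (a - b) + T * (A - a) + - (T * (B - b))) * (1 / S) = T * (A - B) / S"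
      for T a b A B S :: real by (simp add: algebra_simps diff_divide_distrib)
    then show ?thesis
      using k unfolding coth_excess_def K_def by (subst V_mult_V) (simp_all only: of_nat_0_less_iff)
  qed
  ultimately have "(\<Sum>\<^sub>\<infinity>j. V j * V (k - j)) =
      (2 * S + 2 * G) * (1 / sinh (pi / s * K)) + 2 * (p * (s / pi) * V k)"
    by (simp add: infsumI)
  \<comment> \<open>Here the lower powers in \<open>S\<close> cancel against the rational constants
    in \<open>G\<close>.\<close>
  moreover have "2 * S + 2 * G = K * (p\<^sup>2 * (K ^ 2 / 3 - 2 * e2 s)
      + p * q * (K ^ 4 / 5 - 8 * e4 s - 2 * K ^ 2 * e2 s)
      + q\<^sup>2 * (K ^ 6 / 70 - 2 * K ^ 2 * e4 s - 6 * e6 s))"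
    unfolding S_def G_def by (simp add: field_simps eval_nat_numeral)
  moreover have "u_coeff s k = K * (1 / sinh (pi / s * K))"
    using k by (simp add: u_coeff_def K_def mult_ac)
  moreover have "K * R * I + 2 * (p * w * (Q * (K * I))) = K * I * (R + 2 * w * p * Q)"
    for R I w Q :: real by (simp add: algebra_simps)
  ultimately show ?thesis
    unfolding V_def K_def by (simp only:)
qed

lemma convolution_V:
  assumes "k \<noteq> 0"
  shows "(\<Sum>\<^sub>\<infinity>j. V j * V (k - j)) = u_coeff s k *
    (p\<^sup>2 * (k ^ 2 / 3 - 2 * e2 s) + p * q * (k ^ 4 / 5 - 8 * e4 s - 2 * k ^ 2 * e2 s)
      + q\<^sup>2 * (k ^ 6 / 70 - 2 * k ^ 2 * e4 s - 6 * e6 s) + 2 * (s / pi) * p * (p + q * k ^ 2))"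
proof (cases k rule: int_cases3)
  case (pos n)
  then show ?thesis by (rule convolution_V_pos)
next
  case (neg n)
  have "(\<Sum>\<^sub>\<infinity>j. V j * V (k - j)) = (\<Sum>\<^sub>\<infinity>j. V (- j) * V (k - - j))"
    by (rule infsum_reindex_bij_betw[symmetric, OF bij_uminus])
  also have "\<dots> = (\<Sum>\<^sub>\<infinity>j. V j * V (- k - j))"
  proof -
    have "V (k + j) = V (- k - j)" for j
    proof -
      have "- k - j = - (k + j)" by simp
      then show ?thesis by (simp only: V_minus)
    qed
    then show ?thesis by (simp add: V_minus)
  qed
  finally show ?thesis
    using convolution_V_pos[of "- k" n] neg by (simp add: u_coeff_def)
qed (use assms in simp)

end

section \<open>The travelling wave\<close>

lemma u_eq_cos_series:
  assumes "s > 0"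
  shows "u s = cos_series (u_coeff s) 0"
proof
  fix x
  let ?f = "\<lambda>k::int. of_real (u_coeff s k) * exp (- \<i> * of_int k * of_real x)"
  have "(\<lambda>k. norm (u_coeff s k)) summable_on UNIV"
    using rapidly_decreasing_norm_summable[OF rapidly_decreasing_u_coeff[OF assms], of 0] by simp
  then have "(\<lambda>k. norm (?f k)) summable_on UNIV" by (simp add: norm_mult)
  then have "?f summable_on UNIV" by (rule abs_summable_summable)
  then have "u s x = (\<Sum>\<^sub>\<infinity>k. Re (?f k))"
    unfolding u_def by (rule infsum_Re[symmetric])
  then show "u s x = cos_series (u_coeff s) 0 x"
    by (simp add: cos_series_def Re_exp)
qed

context quadratic_multiplier
begin

lemma V_rapid: "rapidly_decreasing V"
  unfolding V_def by (intro rapidly_decreasing_quadratic_mult rapidly_decreasing_u_coeff s)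

text \<open>The second derivative shifts the phase by \<open>pi\<close>, which reverses the sign and
  turns \<open>- q u''\<close> into the multiplier \<open>+ q k^2\<close>.\<close>

lemma cos_series_V: "p * u s x - q * (deriv ^^ 2) (u s) x = cos_series V 0 x"
proof -
  note rd = rapidly_decreasing_u_coeff[OF s]
  have "((\<lambda>k. p * (u_coeff s k * cos (of_int k * x)) + (- q) *
      (u_coeff s k * of_int k ^ 2 * cos (of_int k * x + real 2 * (pi / 2)))) has_sum
    (p * cos_series (u_coeff s) 0 x + (- q) * cos_series (u_coeff s) 2 x)) UNIV"
    unfolding cos_series_def
    using cos_series_summable[OF rd, of 0 x] cos_series_summable[OF rd, of 2 x]
    by (intro has_sum_add has_sum_cmult_right) (simp_all add: has_sum_infsum)
  then have "((\<lambda>k. V k * cos (of_int k * x)) has_sum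
    (p * cos_series (u_coeff s) 0 x + (- q) * cos_series (u_coeff s) 2 x)) UNIV"
    by (simp add: V_def algebra_simps)
  then show ?thesis
    unfolding u_eq_cos_series[OF s] deriv_funpow_cos_series[OF rd]
    by (simp add: cos_series_def[of V] infsumI)
qed

lemma cos_series_V_square:
  assumes eq: "\<And>k::real. p\<^sup>2 * (k ^ 2 / 3 - 2 * e2 s)
      + p * q * (k ^ 4 / 5 - 8 * e4 s - 2 * k ^ 2 * e2 s)
      + q\<^sup>2 * (k ^ 6 / 70 - 2 * k ^ 2 * e4 s - 6 * e6 s) + 2 * (s / pi) * p * (p + q * k ^ 2)
      = 2 * (p + q * k ^ 2) * (c + \<alpha> * k ^ 2 + \<beta> * k ^ 4)"
  obtains K where "\<And>x. cos_series V 0 x ^ 2 =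
    K + 2 * c * cos_series V 0 x - 2 * \<alpha> * cos_series V 2 x + 2 * \<beta> * cos_series V 4 x"
proof
  fix x
  define conv where "conv k = (\<Sum>\<^sub>\<infinity>j. V j * V (k - j))" for k
  have conv: "conv k = 2 * (c + \<alpha> * of_int k ^ 2 + \<beta> * of_int k ^ 4) * V k" if "k \<noteq> 0" for k
    unfolding conv_def convolution_V[OF that] eq by (simp only: V_def mult_ac)
  \<comment> \<open>\<open>convolution_V\<close> excludes \<open>k = 0\<close>; that Fourier mode is
    constant in \<open>x\<close>, so its discrepancy becomes the constant \<open>K\<close>.\<close>
  have "((\<lambda>k. if k = 0 then conv 0 - 2 * c * V 0 else 0) has_sum (conv 0 - 2 * c * V 0)) UNIV"
    by (rule iffD1[OF has_sum_cong_neutral, rotated 3, OF has_sum_finite[of "{0}" "\<lambda>_. conv 0 - 2 * c * V 0"], simplified]) auto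
  then have "((\<lambda>k. (if k = 0 then conv 0 - 2 * c * V 0 else 0)
     + 2 * c * (V k * of_int k ^ 0 * cos (of_int k * x + real 0 * (pi / 2)))
     + (- 2 * \<alpha>) * (V k * of_int k ^ 2 * cos (of_int k * x + real 2 * (pi / 2)))
     + 2 * \<beta> * (V k * of_int k ^ 4 * cos (of_int k * x + real 4 * (pi / 2)))) has_sum
    (conv 0 - 2 * c * V 0) + 2 * c * cos_series V 0 x + (- 2 * \<alpha>) * cos_series V 2 x
      + 2 * \<beta> * cos_series V 4 x) UNIV"
    unfolding cos_series_def
    by (intro has_sum_add has_sum_cmult_right has_sum_infsum cos_series_summable[OF V_rapid])
  moreover have "(if k = 0 then conv 0 - 2 * c * V 0 else 0)
     + 2 * c * (V k * of_int k ^ 0 * cos (of_int k * x + real 0 * (pi / 2)))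
     + (- 2 * \<alpha>) * (V k * of_int k ^ 2 * cos (of_int k * x + real 2 * (pi / 2)))
     + 2 * \<beta> * (V k * of_int k ^ 4 * cos (of_int k * x + real 4 * (pi / 2)))
     = conv k * cos (of_int k * x)" for k
  proof -
    have "cos (y + real 4 * (pi / 2)) = cos y" for y
      using cos_periodic[of y] by (simp add: mult.commute)
    then show ?thesis by (cases "k = 0") (simp_all add: conv algebra_simps)
  qed
  ultimately have "((\<lambda>k. conv k * cos (of_int k * x)) has_sum
    (conv 0 - 2 * c * V 0) + 2 * c * cos_series V 0 x + (- 2 * \<alpha>) * cos_series V 2 x
      + 2 * \<beta> * cos_series V 4 x) UNIV" by simp
  then show "cos_series V 0 x ^ 2 = (conv 0 - 2 * c * V 0) + 2 * c * cos_series V 0 x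
      - 2 * \<alpha> * cos_series V 2 x + 2 * \<beta> * cos_series V 4 x"
    using cos_series_square[OF V_rapid V_minus, of x]
    by (simp add: infsumI flip: conv_def)
qed

lemma kawahara_ode:
  assumes "\<And>k::real. p\<^sup>2 * (k ^ 2 / 3 - 2 * e2 s)
      + p * q * (k ^ 4 / 5 - 8 * e4 s - 2 * k ^ 2 * e2 s)
      + q\<^sup>2 * (k ^ 6 / 70 - 2 * k ^ 2 * e4 s - 6 * e6 s) + 2 * (s / pi) * p * (p + q * k ^ 2)
      = 2 * (p + q * k ^ 2) * (c + \<alpha> * k ^ 2 + \<beta> * k ^ 4)"
  shows "- c * cos_series V 1 x + cos_series V 0 x * cos_series V 1 x
    + \<alpha> * cos_series V 3 x - \<beta> * cos_series V 5 x = 0"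
proof -
  obtain K where K: "\<And>x. cos_series V 0 x ^ 2 =
    K + 2 * c * cos_series V 0 x - 2 * \<alpha> * cos_series V 2 x + 2 * \<beta> * cos_series V 4 x"
    using cos_series_V_square[OF assms] by blast
  have d: "(cos_series V m has_real_derivative cos_series V (Suc m) x) (at x)" for m
    by (rule cos_series_has_derivative[OF V_rapid])
  have "((\<lambda>x. cos_series V 0 x ^ 2) has_real_derivative
      2 * cos_series V 0 x * cos_series V 1 x) (at x)"
    using d[of 0] by (auto intro!: derivative_eq_intros)
  moreover have "((\<lambda>x. K + 2 * c * cos_series V 0 x - 2 * \<alpha> * cos_series V 2 x
      + 2 * \<beta> * cos_series V 4 x) has_real_derivative
      2 * c * cos_series V 1 x - 2 * \<alpha> * cos_series V 3 x + 2 * \<beta> * cos_series V 5 x) (at x)"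
    using d[of 0] d[of 2] d[of 4] by (auto intro!: derivative_eq_intros simp: eval_nat_numeral)
  ultimately have "2 * cos_series V 0 x * cos_series V 1 x =
      2 * c * cos_series V 1 x - 2 * \<alpha> * cos_series V 3 x + 2 * \<beta> * cos_series V 5 x"
    unfolding K by (rule DERIV_unique)
  then show ?thesis by simp
qed

lemma kawahara_solution_travelling_wave:
  assumes "\<And>k::real. p\<^sup>2 * (k ^ 2 / 3 - 2 * e2 s)
      + p * q * (k ^ 4 / 5 - 8 * e4 s - 2 * k ^ 2 * e2 s)
      + q\<^sup>2 * (k ^ 6 / 70 - 2 * k ^ 2 * e4 s - 6 * e6 s) + 2 * (s / pi) * p * (p + q * k ^ 2)
      = 2 * (p + q * k ^ 2) * (c + \<alpha> * k ^ 2 + \<beta> * k ^ 4)"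
  shows "kawahara_solution \<alpha> \<beta> (\<lambda>z t. cos_series V 0 (z - c * t))"
proof -
  note d = cos_series_has_derivative[OF V_rapid]
  have dt: "((\<lambda>t. cos_series V 0 (z - c * t)) has_real_derivative
      cos_series V 1 (z - c * t) * - c) (at t)" for z t
    by (rule DERIV_chain2[OF d[of 0, folded One_nat_def]]) (auto intro!: derivative_eq_intros)
  have dz: "((\<lambda>y. cos_series V m (y - a)) has_real_derivative cos_series V (Suc m) (z - a)) (at z)"
    for m z a
    by (rule DERIV_chain2[OF d, of "\<lambda>y. y - a" 1, simplified]) (auto intro!: derivative_eq_intros)
  have dn: "(deriv ^^ m) (\<lambda>y. cos_series V 0 (y - a)) = (\<lambda>y. cos_series V m (y - a))" for m a
    by (rule deriv_funpow_cos_series_shift[OF V_rapid])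
  show ?thesis
    unfolding kawahara_solution_def dn
  proof (intro conjI allI impI)
    show "(\<lambda>t. cos_series V 0 (z - c * t)) differentiable at t" for z t
      using dt real_differentiable_def by blast
    show "(\<lambda>y. cos_series V i (y - c * t)) differentiable at z" for z t i
      using dz real_differentiable_def by blast
    show "deriv (\<lambda>t. cos_series V 0 (z - c * t)) t
        + cos_series V 0 (z - c * t) * deriv (\<lambda>y. cos_series V 0 (y - c * t)) z
        + \<alpha> * cos_series V 3 (z - c * t) - \<beta> * cos_series V 5 (z - c * t) = 0" for z t
      using kawahara_ode[OF assms, of "z - c * t"]
      unfolding DERIV_imp_deriv[OF dt] DERIV_imp_deriv[OF dz] by (simp add: mult_ac)
  qed
qed

end

text \<open>Comparing powers of \<open>k\<close>: \<open>k^6\<close> gives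
  \<open>q = 140 \<beta>\<close>, \<open>k^4\<close> then gives \<open>26 p = 280 \<alpha>\<close>,
  and \<open>k^2\<close> gives \<open>c\<close>, where 31 = 70 - 39 over 507. In the constant term
  \<open>e2 s\<close> and \<open>s / pi\<close> cancel, leaving a multiple of the condition.\<close>

lemma kawahara_coefficients:
  fixes \<alpha> \<beta> s c k :: real
  assumes "\<beta> \<noteq> 0"
    and "31 * \<alpha> ^ 3 + 212940 * \<alpha> * \<beta>\<^sup>2 * e4 s + 2768220 * \<beta> ^ 3 * e6 s = 0"
    and c: "c = 31 * \<alpha>\<^sup>2 / (507 * \<beta>) - 140 / 13 * \<alpha> * (e2 s - s / pi) - 140 * \<beta> * e4 s"
    and pq: "p = 140 / 13 * \<alpha>" "q = 140 * \<beta>"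
  shows "p\<^sup>2 * (k ^ 2 / 3 - 2 * e2 s)
      + p * q * (k ^ 4 / 5 - 8 * e4 s - 2 * k ^ 2 * e2 s)
      + q\<^sup>2 * (k ^ 6 / 70 - 2 * k ^ 2 * e4 s - 6 * e6 s) + 2 * (s / pi) * p * (p + q * k ^ 2)
      = 2 * (p + q * k ^ 2) * (c + \<alpha> * k ^ 2 + \<beta> * k ^ 4)"
proof -
  \<comment> \<open>The condition is linear in \<open>e6 s\<close>; eliminating it leaves a rational
    identity.\<close>
  have e6: "e6 s = - (31 * \<alpha> ^ 3 + 212940 * \<alpha> * \<beta>\<^sup>2 * e4 s) / (2768220 * \<beta> ^ 3)"
    using assms(1,2) by (simp add: field_simps)
  show ?thesis
    unfolding e6 c pq using assms(1) by (simp add: divide_simps) algebra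
qed

section \<open>Existence of the parameter\<close>

text \<open>Convexity of exp: \<open>y\<close> is the convex combination of \<open>0\<close> and
  \<open>x * y\<close> with weight \<open>1 / x\<close> on the latter.\<close>

lemma exp_minus_1_scale:
  fixes x y :: real
  assumes "1 \<le> x"
  shows "x * (exp y - 1) \<le> exp (x * y) - 1"
proof -
  have "convex_on UNIV (exp :: real \<Rightarrow> real)" by (rule exp_convex)
  from convex_onD[OF this, of "1 / x" 0 "x * y"] assms
  have "exp y \<le> (1 - 1 / x) + exp (x * y) / x" by simp
  then have "x * exp y \<le> x * ((1 - 1 / x) + exp (x * y) / x)"
    using assms by (intro mult_left_mono) simp_all
  also have "\<dots> = x - 1 + exp (x * y)" using assms by (simp add: field_simps)
  finally show ?thesis by (simp add: algebra_simps)
qed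

locale dispersion_ratio =
  fixes r :: real
  assumes r: "r > - 13"
begin

text \<open>The two series in \<open>e4\<close> and \<open>e6\<close> combine with weight \<open>13 k\<^sup>2 + r\<close> because
  \<open>2768220 = 13 * 212940\<close>; for \<open>r > -13\<close> all terms are positive.\<close>

definition bose_term :: "nat \<Rightarrow> real \<Rightarrow> real" where
  "bose_term n s = real (Suc n) ^ 3 * (13 * real (Suc n) ^ 2 + r) / (exp (2 * pi * real (Suc n) / s) - 1)"

definition bose_sum :: "real \<Rightarrow> real" where
  "bose_sum s = (\<Sum>n. bose_term n s)"

lemma weight_pos: "0 < real (Suc n) ^ 3 * (13 * real (Suc n) ^ 2 + r)"
proof -
  have "1 \<le> real (Suc n) ^ 2" by simp
  then have "0 < 13 * real (Suc n) ^ 2 + r" using r by linarith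
  then show ?thesis by simp
qed

lemma exp_gt_1: "s > 0 \<Longrightarrow> 1 < exp (2 * pi * real (Suc n) / s)"
  by simp

lemma bose_term_nonneg: "s > 0 \<Longrightarrow> 0 \<le> bose_term n s"
  unfolding bose_term_def using weight_pos[of n] exp_gt_1[of s n]
  by (intro divide_nonneg_pos) auto

lemma bose_term_mono:
  assumes "0 < s" "s \<le> t"
  shows "bose_term n s \<le> bose_term n t"
  unfolding bose_term_def
proof (rule divide_left_mono)
  show "exp (2 * pi * real (Suc n) / t) - 1 \<le> exp (2 * pi * real (Suc n) / s) - 1"
    using assms by (simp add: divide_left_mono del: of_nat_Suc)
  show "0 < (exp (2 * pi * real (Suc n) / s) - 1) * (exp (2 * pi * real (Suc n) / t) - 1)"
    using assms exp_gt_1[of s n] exp_gt_1[of t n] by simp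
qed (use weight_pos[of n] in simp)

text \<open>\<open>exp_minus_1_scale\<close> with factor \<open>1 / s\<close>; it makes
  \<open>bose_sum\<close> small near 0.\<close>

lemma bose_term_le_linear:
  assumes "0 < s" "s \<le> 1"
  shows "bose_term n s \<le> s * bose_term n 1"
proof -
  define y where "y = 2 * pi * real (Suc n)"
  have y: "0 < exp y - 1" by (simp add: y_def)
  have "1 / s * (exp y - 1) \<le> exp (1 / s * y) - 1"
    using assms by (intro exp_minus_1_scale) simp
  then have le: "(exp y - 1) / s \<le> exp (y / s) - 1" by simp
  have "0 < (exp y - 1) / s" using y assms by simp
  then have "bose_term n s \<le> real (Suc n) ^ 3 * (13 * real (Suc n) ^ 2 + r) / ((exp y - 1) / s)"
    unfolding bose_term_def y_def[symmetric] using le weight_pos[of n]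
    by (intro divide_left_mono mult_pos_pos) linarith+
  also have "\<dots> = s * bose_term n 1" by (simp add: bose_term_def y_def)
  finally show ?thesis .
qed

text \<open>The constants are 3549 = 212940 / 60, 21970 = 2768220 / 126 and 851760 = 4 *
  212940.\<close>

lemma bose_sum:
  assumes "s > 0"
  shows "summable (\<lambda>n. bose_term n s)"
    and "31 * r ^ 3 + 212940 * r * e4 s + 2768220 * e6 s =
      (31 * r ^ 3 - 3549 * r + 21970) - 851760 * bose_sum s"
proof -
  define S where "S m = (\<Sum>n. real (Suc n) ^ m / (1 - exp (2 * pi * real (Suc n) / s)))" for m
  have S: "(\<lambda>n. real (Suc n) ^ m / (1 - exp (2 * pi * real (Suc n) / s))) sums S m" if "odd m" for m
    using coth_excess_moment_odd[OF assms that] unfolding S_def by (simp only: sums_iff)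
  have "(\<lambda>n. - 13 * (real (Suc n) ^ 5 / (1 - exp (2 * pi * real (Suc n) / s)))
      + - r * (real (Suc n) ^ 3 / (1 - exp (2 * pi * real (Suc n) / s)))) sums (- 13 * S 5 + - r * S 3)"
    by (intro sums_add sums_mult S) simp_all
  moreover have "- 13 * (real (Suc n) ^ 5 / (1 - exp (2 * pi * real (Suc n) / s)))
      + - r * (real (Suc n) ^ 3 / (1 - exp (2 * pi * real (Suc n) / s))) = bose_term n s" for n
  proof -
    have "- 13 * (a ^ 5 / (1 - E)) + - r * (a ^ 3 / (1 - E)) = a ^ 3 * (13 * a ^ 2 + r) / (E - 1)"
      if "E > 1" for a E :: real
    proof -
      have "1 - E = - (E - 1)" by simp
      then have "- 13 * (a ^ 5 / (1 - E)) + - r * (a ^ 3 / (1 - E)) = (13 * a ^ 5 + r * a ^ 3) / (E - 1)"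
        by (simp only: divide_minus_right) (simp add: add_divide_distrib)
      then show ?thesis by (simp add: algebra_simps eval_nat_numeral)
    qed
    then show ?thesis unfolding bose_term_def using exp_gt_1[OF assms, of n] by blast
  qed
  moreover have "e4 s = - 1 / 60 + 4 * S 3" "e6 s = 1 / 126 + 4 * S 5"
    by (simp_all only: e4_def e6_def S_def)
  ultimately have "(\<lambda>n. bose_term n s) sums (- 13 * S 5 + - r * S 3)"
    and e46: "e4 s = - 1 / 60 + 4 * S 3" "e6 s = 1 / 126 + 4 * S 5" by simp_all
  then show "summable (\<lambda>n. bose_term n s)"
    and "31 * r ^ 3 + 212940 * r * e4 s + 2768220 * e6 s =
      (31 * r ^ 3 - 3549 * r + 21970) - 851760 * bose_sum s"
    by (simp_all add: sums_iff bose_sum_def e46 algebra_simps)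
qed

text \<open>By monotonicity in \<open>s\<close>, the terms at the right endpoint \<open>b\<close>
  serve as majorants in the Weierstrass test.\<close>

lemma continuous_on_bose_sum:
  assumes "0 < a"
  shows "continuous_on {a..b} bose_sum"
  unfolding bose_sum_def
proof (cases "a \<le> b")
  case True
  have "uniform_limit {a..b} (\<lambda>n s. \<Sum>i<n. bose_term i s) (\<lambda>s. \<Sum>i. bose_term i s) sequentially"
  proof (rule Weierstrass_m_test)
    show "norm (bose_term n s) \<le> bose_term n b" if "s \<in> {a..b}" for n s
      using that assms bose_term_mono[of s b n] bose_term_nonneg[of s n] by simp
    show "summable (\<lambda>n. bose_term n b)" using assms True by (intro bose_sum) simp
  qed
  then show "continuous_on {a..b} (\<lambda>s. \<Sum>i. bose_term i s)"
  proof (rule uniform_limit_theorem[rotated])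
    have "exp (2 * pi * real (Suc i) / s) - 1 \<noteq> 0" if "s \<in> {a..b}" for i s
      using that assms exp_gt_1[of s i] by simp
    then show "\<forall>\<^sub>F n in sequentially. continuous_on {a..b} (\<lambda>s. \<Sum>i<n. bose_term i s)"
      unfolding bose_term_def using assms
      by (intro always_eventually allI continuous_intros) auto
  qed simp
qed simp

lemma bose_sum_attains:
  assumes "L > 0"
  shows "\<exists>s>0. bose_sum s = L"
proof -
  \<comment> \<open>Chosen so that the linear bound gives at most \<open>L\<close>; the
    \<open>+ 1\<close> keeps the denominator positive.\<close>
  define a where "a = min 1 (L / (bose_sum 1 + 1))"
  \<comment> \<open>The second argument solves \<open>bose_term 0 s = L\<close>, so the first term
    alone reaches \<open>L\<close>; the maximum ensures \<open>a \<le> b\<close>.\<close>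
  define b where "b = max a (2 * pi / ln (1 + (13 + r) / L))"
  have B1: "bose_sum 1 \<ge> 0"
    unfolding bose_sum_def by (intro suminf_nonneg bose_sum bose_term_nonneg) simp_all
  then have a: "0 < a" "a \<le> 1" "a \<le> L / (bose_sum 1 + 1)" using assms by (auto simp: a_def)
  have "bose_sum a \<le> (\<Sum>n. a * bose_term n 1)"
    unfolding bose_sum_def by (intro suminf_le bose_term_le_linear bose_sum summable_mult a) simp
  also have "\<dots> = a * bose_sum 1"
    unfolding bose_sum_def by (intro suminf_mult bose_sum) simp
  also have "\<dots> \<le> a * (bose_sum 1 + 1)" using a by simp
  also have "\<dots> \<le> L" using a B1 by (simp add: field_simps)
  finally have lo: "bose_sum a \<le> L" .
  have q: "(13 + r) / L > 0" using r assms by simp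
  then have ln: "ln (1 + (13 + r) / L) > 0" by simp
  then have "2 * pi / ln (1 + (13 + r) / L) > 0" by simp
  moreover have "bose_term 0 (2 * pi / ln (1 + (13 + r) / L)) = L"
  proof -
    have "exp (ln (1 + (13 + r) / L)) = 1 + (13 + r) / L" using q by (intro exp_ln) simp
    then show ?thesis using ln r assms by (simp add: bose_term_def)
  qed
  ultimately have "L \<le> bose_term 0 b"
    using bose_term_mono[of "2 * pi / ln (1 + (13 + r) / L)" b 0] by (simp add: b_def)
  also have "b > 0" "a \<le> b" using a by (auto simp: b_def)
  then have "bose_term 0 b \<le> bose_sum b"
    using sum_le_suminf[OF bose_sum(1), of b "{0}"] bose_term_nonneg[of b] by (simp add: bose_sum_def)
  finally have hi: "L \<le> bose_sum b" .
  obtain s where "a \<le> s" "s \<le> b" "bose_sum s = L"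
    using IVT'[OF lo hi \<open>a \<le> b\<close> continuous_on_bose_sum[OF a(1)]] by blast
  then show ?thesis using a(1) by (intro exI[of _ s]) simp
qed

text \<open>The limit of the left-hand side as \<open>s \<rightarrow> 0\<close> has the zero \<open>r = -13\<close>; its other factor is positive.\<close>

lemma exists_modulus: "\<exists>s>0. 31 * r ^ 3 + 212940 * r * e4 s + 2768220 * e6 s = 0"
proof -
  have "31 * r ^ 3 - 3549 * r + 21970 = (r + 13) * (31 * (r - 13 / 2)\<^sup>2 + 1521 / 4)"
    by (simp add: field_simps eval_nat_numeral)
  moreover have "31 * (r - 13 / 2)\<^sup>2 + 1521 / 4 > 0" by (intro add_nonneg_pos) simp_all
  ultimately have "(31 * r ^ 3 - 3549 * r + 21970) / 851760 > 0" using r by simp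
  from bose_sum_attains[OF this] obtain s where "s > 0"
    and "bose_sum s = (31 * r ^ 3 - 3549 * r + 21970) / 851760" by blast
  then show ?thesis by (intro exI[of _ s]) (simp add: bose_sum(2))
qed

end

theorem mainTheorem4:
  fixes \<alpha> \<beta> :: real
  assumes "\<beta> \<noteq> 0" and "\<alpha> / \<beta> > - 13"
  shows "(\<exists>s\<^sub>0>0. 31 * \<alpha> ^ 3 + 212940 * \<alpha> * \<beta>\<^sup>2 * e4 s\<^sub>0 + 2768220 * \<beta> ^ 3 * e6 s\<^sub>0 = 0) \<and>
    (\<forall>s\<^sub>0>0. \<forall>c v.
       31 * \<alpha> ^ 3 + 212940 * \<alpha> * \<beta>\<^sup>2 * e4 s\<^sub>0 + 2768220 * \<beta> ^ 3 * e6 s\<^sub>0 = 0 \<longrightarrow>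
       c = 31 * \<alpha>\<^sup>2 / (507 * \<beta>) - 140 / 13 * \<alpha> * (e2 s\<^sub>0 - s\<^sub>0 / pi) - 140 * \<beta> * e4 s\<^sub>0 \<longrightarrow>
       v = (\<lambda>z t. 140 / 13 * \<alpha> * u s\<^sub>0 (z - c * t)
                  - 140 * \<beta> * (deriv ^^ 2) (u s\<^sub>0) (z - c * t)) \<longrightarrow>
       (\<forall>z t. v (z + 2 * pi) t = v z t) \<and> kawahara_solution \<alpha> \<beta> v)"
proof (intro conjI allI impI)
  interpret dispersion_ratio "\<alpha> / \<beta>" by unfold_locales (use assms in simp)
  obtain s where "s > 0" and s: "31 * (\<alpha> / \<beta>) ^ 3 + 212940 * (\<alpha> / \<beta>) * e4 s + 2768220 * e6 s = 0"
    using exists_modulus by blast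
  \<comment> \<open>The condition is homogeneous of degree 3 in \<open>\<alpha>\<close> and
    \<open>\<beta>\<close>, so only their ratio matters.\<close>
  have "31 * \<alpha> ^ 3 + 212940 * \<alpha> * \<beta>\<^sup>2 * e4 s + 2768220 * \<beta> ^ 3 * e6 s =
      \<beta> ^ 3 * (31 * (\<alpha> / \<beta>) ^ 3 + 212940 * (\<alpha> / \<beta>) * e4 s + 2768220 * e6 s)"
    using assms(1) by (simp add: field_simps eval_nat_numeral)
  then show "\<exists>s\<^sub>0>0. 31 * \<alpha> ^ 3 + 212940 * \<alpha> * \<beta>\<^sup>2 * e4 s\<^sub>0 + 2768220 * \<beta> ^ 3 * e6 s\<^sub>0 = 0"
    using \<open>s > 0\<close> unfolding s by auto
next
  fix s c :: real and v
  assume s: "0 < s" and e: "31 * \<alpha> ^ 3 + 212940 * \<alpha> * \<beta>\<^sup>2 * e4 s + 2768220 * \<beta> ^ 3 * e6 s = 0"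
    and c: "c = 31 * \<alpha>\<^sup>2 / (507 * \<beta>) - 140 / 13 * \<alpha> * (e2 s - s / pi) - 140 * \<beta> * e4 s"
    and v: "v = (\<lambda>z t. 140 / 13 * \<alpha> * u s (z - c * t) - 140 * \<beta> * (deriv ^^ 2) (u s) (z - c * t))"
  interpret quadratic_multiplier s "140 / 13 * \<alpha>" "140 * \<beta>" by unfold_locales (rule s)
  have v': "v = (\<lambda>z t. cos_series V 0 (z - c * t))"
    unfolding v cos_series_V ..
  show "kawahara_solution \<alpha> \<beta> v"
    unfolding v' by (rule kawahara_solution_travelling_wave)
      (rule kawahara_coefficients[OF assms(1) e c refl refl])
  show "v (z + 2 * pi) t = v z t" for z t
    using cos_series_periodic[of V 0 "z - c * t"] by (simp add: v' algebra_simps)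
qed

end
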